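(* Let $X$ be a finite-dimensional Banach space, let $E=(x_1,\dots,x_n,-x_1,\dots,-x_n)$ be a direction set in $X$, and let $p\in\mathcal{N}(X)$ be an equivalent norm with closed unit ball $B_p$. Then the following statements are equivalent: 1) $\operatorname{Ext}(B_p)\subset \operatorname{Dir}(E)$. 2) There exists an $E$-admissible multiindex $\alpha$ such that $p(x)=\rho(x;\alpha E)$ for all $x\in X$.
   Context: $\mathcal{N}(X)$ is the set of equivalent norms on $X$, and $B_p=\{x\in X: p(x)\le 1\}$. A direction set in $(X,\|\cdot\|)$ is a finite subset $E\subset S_X$ of the unit sphere with $E=-E$ and $\operatorname{conv}(E)$ having nonempty interior; choosing one representative from each antipodal pair, write $E=\{\pm x_1,\dots,\pm x_n\}$ (cardinality $2n$), also regarded as the ordered list $(x_1,\dots,x_n,-x_1,\dots,-x_n)$. $\operatorname{Dir}(E)=\{cx: c>0,\ x\in E\}$, and $\operatorname{Ext}(B)$ is the set of extreme points of a convex set $B$. A multiindex is a vector $\alpha=(\alpha_1,\dots,\alpha_n)$ of real numbers, and $\alpha>0$ means all $\alpha_i>0$. For $\alpha>0$, $\operatorname{conv}(\alpha E)=\operatorname{conv}\{\pm\alpha_1^{-1}x_1,\dots,\pm\alpha_n^{-1}x_n\}$ and $\rho(x;\alpha E)=\inf\{r>0: x\in r\operatorname{conv}(\alpha E)\}$. The multiindex $\alpha>0$ is $E$-admissible if for every $i\in\{1,\dots,n\}$ and every $0<\varepsilon_i<\alpha_i$, with $\alpha'=(\alpha_1,\dots,\alpha_i-\varepsilon_i,\dots,\alpha_n)$,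 one has $\rho(\cdot;\alpha'E)\ne\rho(\cdot;\alpha E)$. *)

theory Defs
  imports "HOL-Analysis.Analysis"
begin

definition equivalent_norm :: "('a::real_normed_vector \<Rightarrow> real) \<Rightarrow> bool" where
  "equivalent_norm p \<longleftrightarrow>
     (\<forall>x. p x = 0 \<longleftrightarrow> x = 0) \<and>
     (\<forall>x y. p (x + y) \<le> p x + p y) \<and>
     (\<forall>c x. p (c *\<^sub>R x) = \<bar>c\<bar> * p x) \<and>
     (\<exists>a>0. \<exists>b>0. \<forall>x. a * norm x \<le> p x \<and> p x \<le> b * norm x)"

definition unit_ball :: "('a \<Rightarrow> real) \<Rightarrow> 'a set" where
  "unit_ball p = {x. p x \<le> 1}"

definition Ext :: "'a::real_vector set \<Rightarrow> 'a set" where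
  "Ext B = {x. x extreme_point_of B}"

definition direction_set :: "'a::real_normed_vector set \<Rightarrow> bool" where
  "direction_set E \<longleftrightarrow>
     finite E \<and> E \<subseteq> sphere 0 1 \<and> E = uminus ` E \<and> interior (convex hull E) \<noteq> {}"

text \<open>The vectors \<open>x 1, \<dots>, x n\<close> represent the antipodal pairs of \<open>E\<close>; the cardinality
  condition says that each pair is represented exactly once.  Values of \<open>x\<close> outside
  \<open>{1..n}\<close> are irrelevant, and likewise for multiindices \<open>\<alpha>\<close> below.\<close>

definition antipodal_enumeration :: "nat \<Rightarrow> (nat \<Rightarrow> 'a::real_vector) \<Rightarrow> 'a set \<Rightarrow> bool" where
  "antipodal_enumeration n x E \<longleftrightarrow>
     E = x ` {1..n} \<union> (\<lambda>i. - x i) ` {1..n} \<and> card E = 2 * n"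

definition Dir :: "'a::real_vector set \<Rightarrow> 'a set" where
  "Dir E = {c *\<^sub>R x | c x. c > 0 \<and> x \<in> E}"

definition scaled_hull :: "nat \<Rightarrow> (nat \<Rightarrow> 'a::real_vector) \<Rightarrow> (nat \<Rightarrow> real) \<Rightarrow> 'a set" where
  "scaled_hull n x \<alpha> =
     convex hull ((\<lambda>i. inverse (\<alpha> i) *\<^sub>R x i) ` {1..n} \<union> (\<lambda>i. - (inverse (\<alpha> i) *\<^sub>R x i)) ` {1..n})"

text \<open>The infimum is over a nonempty set whenever \<open>\<alpha>\<close> is positive on \<open>{1..n}\<close> and \<open>x\<close> enumerates
  a direction set, since the hull then contains a neighbourhood of \<open>0\<close>.\<close>

definition rho :: "nat \<Rightarrow> (nat \<Rightarrow> 'a::real_vector) \<Rightarrow> (nat \<Rightarrow> real) \<Rightarrow> 'a \<Rightarrow> real" where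
  "rho n x \<alpha> y = Inf {r. r > 0 \<and> y \<in> (\<lambda>z. r *\<^sub>R z) ` scaled_hull n x \<alpha>}"

definition admissible :: "nat \<Rightarrow> (nat \<Rightarrow> 'a::real_vector) \<Rightarrow> (nat \<Rightarrow> real) \<Rightarrow> bool" where
  "admissible n x \<alpha> \<longleftrightarrow>
     (\<forall>i\<in>{1..n}. \<alpha> i > 0) \<and>
     (\<forall>i\<in>{1..n}. \<forall>\<epsilon>. 0 < \<epsilon> \<and> \<epsilon> < \<alpha> i \<longrightarrow> rho n x (\<alpha>(i := \<alpha> i - \<epsilon>)) \<noteq> rho n x \<alpha>)"

end

theory Submission
  imports Defs
begin

text \<open>
  The hull of the points \<open>\<plusminus>x\<^sub>i / \<alpha>\<^sub>i\<close> is a compact convex body, so it is exactly the unit ball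
  of its own gauge.  If \<open>p\<close> is that gauge, an extreme point of its unit ball is an extreme
  point of the convex hull of a finite set, hence one of the points spanning it, and these
  lie in \<open>Dir E\<close>.

  Conversely, put \<open>\<alpha>\<^sub>i = p x\<^sub>i\<close>, which places \<open>\<plusminus>x\<^sub>i / \<alpha>\<^sub>i\<close> on the unit sphere of \<open>p\<close>.  An
  extreme point of the ball that points in a direction of \<open>E\<close> is a multiple, by a factor at
  most \<open>1\<close>, of one of these points and so lies in their hull.  By Minkowski's theorem
  (a compact convex set is the hull of its extreme points) the ball lies in the hull, and the
  two sets coincide.  The multiindex is admissible because lowering \<open>\<alpha>\<^sub>i\<close> pulls the gauge of
  \<open>x\<^sub>i\<close> strictly below \<open>p x\<^sub>i\<close>.

  Minkowski's theorem is needed in a finite-dimensional normed space without inner product.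
  It is obtained here from a maximum principle of Bauer type: a continuous convex function
  attains its maximum over a compact set at an extreme point, provided there is a continuous
  strictly quasiconvex function to break ties.  Applied to the distance from the hull
  (\<open>compact_subset_if_extreme_points_subset\<close>), it forbids points of the ball outside the hull.
  The tie-breaking function is the sum of the squared coordinates in a basis.  Its
  continuity, like the compactness of the ball, follows from the fact that the convex hull
  of the finite set \<open>E\<close> contains a ball around the origin.
\<close>

section \<open>Extreme points as maximisers\<close>

text \<open>
  If a maximiser of a convex \<open>g\<close> lies strictly inside a segment of \<open>K\<close>, both ends of
  the segment are maximisers too.  Maximising \<open>q\<close> over the maximisers of \<open>g\<close> therefore leaves
  only extreme points of \<open>K\<close> itself.
\<close>
lemma convex_function_max_at_extreme_point:
  fixes K :: "'a::real_normed_vector set" and g q :: "'a \<Rightarrow> real"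
  assumes K: "compact K" "K \<noteq> {}"
    and g: "continuous_on K g" "convex_on UNIV g"
    and q: "continuous_on K q"
    and strict: "\<And>a b z. z \<in> open_segment a b \<Longrightarrow> q z < max (q a) (q b)"
  obtains e where "e extreme_point_of K" "\<And>y. y \<in> K \<Longrightarrow> g y \<le> g e"
proof -
  obtain m where m: "m \<in> K" "\<And>y. y \<in> K \<Longrightarrow> g y \<le> g m"
    using continuous_attains_sup[OF K g(1)] by blast
  define M where "M = {y \<in> K. g y = g m}"
  have "closedin (top_of_set K) M"
    unfolding M_def by (rule continuous_closedin_preimage_constant[OF g(1)])
  then have M: "compact M" "M \<noteq> {}" "continuous_on M q"
    using K(1) closedin_compact m q unfolding M_def by (blast intro: continuous_on_subset)+
  obtain e where e: "e \<in> M" "\<And>y. y \<in> M \<Longrightarrow> q y \<le> q e"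
    using continuous_attains_sup[OF M] by blast
  have "e \<notin> open_segment a b" if ab: "a \<in> K" "b \<in> K" for a b
  proof
    assume seg: "e \<in> open_segment a b"
    then obtain u where u: "0 < u" "u < 1" and eu: "e = (1 - u) *\<^sub>R a + u *\<^sub>R b"
      by (auto simp: in_segment)
    have "g e \<le> (1 - u) * g a + u * g b"
      unfolding eu using convex_onD[OF g(2), of u a b] u by auto
    moreover have "g e = g m"
      using e(1) by (simp add: M_def)
    moreover have "g a \<le> g m" "g b \<le> g m"
      using m ab by auto
    moreover have "(1 - u) * g a \<le> (1 - u) * g m" "u * g b \<le> u * g m"
      using m ab u by (auto intro: mult_left_mono)
    ultimately have "(1 - u) * g a = (1 - u) * g m" "u * g b = u * g m"
      by (simp_all only: left_diff_distrib mult_1)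
    then have "a \<in> M" "b \<in> M"
      using u ab by (auto simp: M_def)
    then show False
      using strict[OF seg] e(2)[of a] e(2)[of b] by linarith
  qed
  then have "e extreme_point_of K"
    using e(1) by (auto simp: extreme_point_of_def M_def)
  with m e(1) show thesis
    by (intro that) (auto simp: M_def)
qed

lemma convex_on_infdist_compact:
  fixes H :: "'a::real_normed_vector set"
  assumes "compact H" "convex H" "H \<noteq> {}"
  shows "convex_on UNIV (\<lambda>y. infdist y H)"
proof (rule convex_onI)
  have nearest: "\<exists>h\<in>H. infdist y H = dist y h" for y
  proof -
    obtain h where "h \<in> H" "\<And>z. z \<in> H \<Longrightarrow> dist y h \<le> dist y z"
      using continuous_attains_inf[OF assms(1,3) continuous_on_dist[OF continuous_on_const
            continuous_on_id]] by blast
    then show ?thesis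
      using assms(3) by (intro bexI[of _ h] antisym infdist_le)
        (auto simp: infdist_notempty intro: cINF_greatest)
  qed
  fix t :: real and a b :: 'a
  assume t: "0 < t" "t < 1"
  obtain c d where c: "c \<in> H" "infdist a H = dist a c" and d: "d \<in> H" "infdist b H = dist b d"
    using nearest by meson
  have "(1 - t) *\<^sub>R c + t *\<^sub>R d \<in> H"
    using assms(2) c d t by (auto intro: convexD)
  then have "infdist ((1 - t) *\<^sub>R a + t *\<^sub>R b) H
      \<le> dist ((1 - t) *\<^sub>R a + t *\<^sub>R b) ((1 - t) *\<^sub>R c + t *\<^sub>R d)"
    by (rule infdist_le)
  also have "\<dots> = norm ((1 - t) *\<^sub>R (a - c) + t *\<^sub>R (b - d))"
    by (simp add: dist_norm algebra_simps)
  also have "\<dots> \<le> (1 - t) * dist a c + t * dist b d"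
    using norm_triangle_ineq[of "(1 - t) *\<^sub>R (a - c)" "t *\<^sub>R (b - d)"] t by (simp add: dist_norm)
  finally show "infdist ((1 - t) *\<^sub>R a + t *\<^sub>R b) H \<le> (1 - t) * infdist a H + t * infdist b H"
    using c d by simp
qed simp

text \<open>
  A point of \<open>K\<close> outside \<open>H\<close> would have positive distance from \<open>H\<close>, and some extreme point
  of \<open>K\<close> would be at least as far away.
\<close>
lemma compact_subset_if_extreme_points_subset:
  fixes K H :: "'a::real_normed_vector set" and q :: "'a \<Rightarrow> real"
  assumes K: "compact K"
    and H: "compact H" "convex H" "Ext K \<subseteq> H"
    and q: "continuous_on K q"
    and strict: "\<And>a b z. z \<in> open_segment a b \<Longrightarrow> q z < max (q a) (q b)"
  shows "K \<subseteq> H"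
proof
  fix y assume y: "y \<in> K"
  then have "K \<noteq> {}" by auto
  obtain e where "e extreme_point_of K"
    using convex_function_max_at_extreme_point[OF K \<open>K \<noteq> {}\<close>, of "\<lambda>_. 0" q] q strict
    by (auto simp: convex_on_def)
  then have "H \<noteq> {}"
    using H(3) by (auto simp: Ext_def)
  have "continuous_on K (\<lambda>y. infdist y H)"
    by (intro continuous_intros)
  then obtain e where e: "e extreme_point_of K" "\<And>y. y \<in> K \<Longrightarrow> infdist y H \<le> infdist e H"
    using convex_function_max_at_extreme_point[OF K \<open>K \<noteq> {}\<close> _
        convex_on_infdist_compact[OF H(1,2) \<open>H \<noteq> {}\<close>] q strict]
    by blast
  have "infdist e H = 0"
    using e(1) H(3) by (auto simp: Ext_def)
  with e(2)[OF y] have "infdist y H = 0"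
    using infdist_nonneg[of y H] by linarith
  then show "y \<in> H"
    using in_closed_iff_infdist_zero compact_imp_closed H(1) \<open>H \<noteq> {}\<close> by blast
qed

section \<open>Topology from a finite set whose hull contains a ball\<close>

lemma convex_symmetric_interior_0:
  fixes C :: "'a::real_normed_vector set"
  assumes "convex C" "uminus ` C \<subseteq> C" "interior C \<noteq> {}"
  obtains d where "d > 0" "cball 0 d \<subseteq> C"
proof -
  obtain z d where z: "z \<in> C" and d: "d > 0" "cball z d \<subseteq> C"
    using assms(3) by (meson all_not_in_conv centre_in_cball less_imp_le mem_interior_cball subsetD)
  have "y \<in> C" if "y \<in> cball 0 (d / 2)" for y
  proof -
    (* y is the midpoint of z + 2 y and - z. *)
    have "z + 2 *\<^sub>R y \<in> C"
      using that d(2) by (auto simp: dist_norm)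
    moreover have "- z \<in> C"
      using z assms(2) by blast
    ultimately have "(1/2) *\<^sub>R (z + 2 *\<^sub>R y) + (1/2) *\<^sub>R (- z) \<in> C"
      by (intro convexD[OF assms(1)]) auto
    then show ?thesis
      by (simp add: algebra_simps)
  qed
  with d(1) show thesis
    by (intro that[of "d / 2"] subsetI) simp_all
qed

lemma direction_set_hull_absorbs:
  assumes "direction_set E"
  obtains d where "d > 0" "cball 0 d \<subseteq> convex hull E"
proof (rule convex_symmetric_interior_0)
  have "uminus ` (convex hull E) = convex hull (uminus ` E)"
    by (rule convex_hull_linear_image) (simp add: linear_uminus)
  then show "uminus ` (convex hull E) \<subseteq> convex hull E"
    using assms unfolding direction_set_def by (metis order_refl)
qed (use assms that in \<open>auto simp: direction_set_def\<close>)

lemma linear_bounded_if_finite_hull_absorbs: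
  fixes f :: "'a::real_normed_vector \<Rightarrow> 'b::real_normed_vector" and F :: "'a set"
  assumes f: "linear f" and F: "finite F" and d: "d > 0" "cball 0 d \<subseteq> convex hull F"
  shows "bounded_linear f"
proof -
  define M where "M = (\<Sum>v\<in>F. norm (f v))"
  have "F \<subseteq> f -` cball 0 M"
    unfolding M_def using F member_le_sum[of _ F "\<lambda>v. norm (f v)"] by auto
  moreover have "convex (f -` cball 0 M)"
    using f by (intro convex_linear_vimage) auto
  ultimately have M: "norm (f y) \<le> M" if "y \<in> convex hull F" for y
    using that hull_minimal[of F "f -` cball 0 M" convex] by auto
  have "norm (f y) \<le> norm y * (M / d)" for y
  proof (cases "y = 0")
    case False
    have "norm (f ((d / norm y) *\<^sub>R y)) \<le> M"
      using d False by (intro M subsetD[OF d(2)]) auto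
    then show ?thesis
      using d(1) False by (simp add: linear_scale[OF f] field_simps)
  qed (simp add: linear_0[OF f])
  then show ?thesis
    using f by (intro bounded_linear_intro[where K = "M / d"])
      (auto simp: linear_add linear_scale)
qed

lemma compact_if_bounded_finite_hull_absorbs:
  fixes K F :: "'a::real_normed_vector set"
  assumes F: "finite F" and d: "d > 0" "cball 0 d \<subseteq> convex hull F"
    and K: "closed K" "bounded K"
  shows "compact K"
proof -
  obtain R where R: "R > 0" "\<And>y. y \<in> K \<Longrightarrow> norm y \<le> R"
    using K(2) bounded_pos by blast
  have "K \<subseteq> (\<lambda>z. (R / d) *\<^sub>R z) ` (convex hull F)"
  proof
    fix y assume "y \<in> K"
    then have "(d / R) *\<^sub>R y \<in> convex hull F"
      using R d(1) by (intro subsetD[OF d(2)]) (auto simp: field_simps)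
    moreover have "y = (R / d) *\<^sub>R ((d / R) *\<^sub>R y)"
      using R(1) d(1) by simp
    ultimately show "y \<in> (\<lambda>z. (R / d) *\<^sub>R z) ` (convex hull F)"
      by blast
  qed
  moreover have "compact ((\<lambda>z. (R / d) *\<^sub>R z) ` (convex hull F))"
    using F by (intro compact_scaling finite_imp_compact_convex_hull)
  ultimately show ?thesis
    using K(1) closed_Int_compact by (metis inf.absorb1)
qed

text \<open>
  The sum of the squared coordinates in a basis is the square of a Euclidean norm, whence the
  strict quasiconvexity that a general norm may lack.
\<close>
lemma strictly_quasiconvex_function_exists:
  fixes F :: "'a::real_normed_vector set"
  assumes fin: "\<exists>B. finite B \<and> span B = (UNIV :: 'a set)"
    and F: "finite F" and d: "d > 0" "cball 0 d \<subseteq> convex hull F"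
  obtains q :: "'a \<Rightarrow> real"
  where "continuous_on UNIV q" "\<And>a b z. z \<in> open_segment a b \<Longrightarrow> q z < max (q a) (q b)"
proof -
  obtain B0 where B0: "finite B0" "span B0 = (UNIV :: 'a set)"
    using fin by blast
  obtain B where B: "B \<subseteq> B0" "independent B" "B0 \<subseteq> span B"
    using maximal_independent_subset by blast
  have fB: "finite B"
    using B B0 finite_subset by blast
  have sB: "span B = UNIV"
    using B(3) B0(2) by (metis span_mono span_span top.extremum_uniqueI)
  define c where "c v y = representation B y v" for v y
  have c_add: "c v (y + z) = c v y + c v z" and c_scale: "c v (t *\<^sub>R y) = t * c v y"
    and c_diff: "c v (y - z) = c v y - c v z" for v y z t
    using B(2) sB unfolding c_def
    by (auto simp: representation_add representation_scale representation_diff)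
  have c_lin: "linear (c v)" for v
    by (rule linearI) (simp_all add: c_add c_scale)
  have c_cont: "continuous_on UNIV (c v)" for v
    using linear_bounded_if_finite_hull_absorbs[OF c_lin F d] linear_continuous_on by blast
  define q where "q y = (\<Sum>v\<in>B. (c v y)\<^sup>2)" for y
  have "continuous_on UNIV q"
    unfolding q_def by (intro continuous_intros c_cont)
  moreover have "q z < max (q a) (q b)" if "z \<in> open_segment a b" for a b z
  proof -
    obtain u where ab: "a \<noteq> b" and u: "0 < u" "u < 1" and zu: "z = (1 - u) *\<^sub>R a + u *\<^sub>R b"
      using \<open>z \<in> open_segment a b\<close> by (auto simp: in_segment)
    have "q (a - b) \<noteq> 0"
    proof
      assume "q (a - b) = 0"
      then have "c v (a - b) = 0" if "v \<in> B" for v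
        using that fB by (simp add: q_def sum_nonneg_eq_0_iff)
      then have "(\<Sum>v\<in>B. representation B (a - b) v *\<^sub>R v) = 0"
        by (simp add: c_def)
      then show False
        using ab sum_representation_eq[OF B(2), of "a - b" B] sB fB by auto
    qed
    then have "q (a - b) > 0"
      unfolding q_def by (metis order_less_le sum_nonneg zero_le_power2)
    moreover have "q z = (1 - u) * q a + u * q b - u * (1 - u) * q (a - b)"
      unfolding q_def zu c_add c_scale c_diff sum_distrib_left sum.distrib[symmetric]
        sum_subtractf[symmetric]
      by (intro sum.cong) (auto simp: power2_eq_square algebra_simps)
    moreover have "(1 - u) * q a + u * q b \<le> max (q a) (q b)"
      using u by (intro convex_bound_le) auto
    ultimately show ?thesis
      using u by (smt (verit) mult_pos_pos)
  qed
  ultimately show thesis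
    using that by blast
qed

section \<open>The gauge of a scaled hull\<close>

lemma compact_scaled_hull: "compact (scaled_hull n (x :: nat \<Rightarrow> 'a::real_normed_vector) \<alpha>)"
  unfolding scaled_hull_def by (intro finite_imp_compact_convex_hull) auto

lemma convex_scaled_hull: "convex (scaled_hull n x \<alpha>)"
  unfolding scaled_hull_def by simp

lemma generator_in_scaled_hull:
  assumes "i \<in> {1..n}"
  shows "inverse (\<alpha> i) *\<^sub>R x i \<in> scaled_hull n x \<alpha>"
    and "- (inverse (\<alpha> i) *\<^sub>R x i) \<in> scaled_hull n x \<alpha>"
  unfolding scaled_hull_def using assms by (auto intro!: hull_inc)

lemma scaled_hull_contains_0:
  assumes "n \<ge> 1"
  shows "0 \<in> scaled_hull n x \<alpha>"
proof -
  have "1 \<in> {1..n}" using assms by simp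
  from generator_in_scaled_hull[OF this, of \<alpha> x]
  have "(1/2) *\<^sub>R (inverse (\<alpha> 1) *\<^sub>R x 1) + (1/2) *\<^sub>R (- (inverse (\<alpha> 1) *\<^sub>R x 1)) \<in> scaled_hull n x \<alpha>"
    by (intro convexD[OF convex_scaled_hull]) auto
  then show ?thesis by simp
qed

lemma scaled_hull_shrink:
  assumes "n \<ge> 1" "y \<in> scaled_hull n x \<alpha>" "0 \<le> t" "t \<le> 1"
  shows "t *\<^sub>R y \<in> scaled_hull n x \<alpha>"
  using convexD[OF convex_scaled_hull assms(2) scaled_hull_contains_0[OF assms(1), of x \<alpha>],
      of t "1 - t"] assms(3,4)
  by simp

lemma rho_le:
  assumes "r > 0" "z \<in> scaled_hull n x \<alpha>"
  shows "rho n x \<alpha> (r *\<^sub>R z) \<le> r"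
  unfolding rho_def using assms by (intro cInf_lower bdd_belowI[of _ 0]) auto

lemma rho_generator_le:
  assumes "i \<in> {1..n}" "\<alpha> i > 0"
  shows "rho n x \<alpha> (x i) \<le> \<alpha> i"
  using rho_le[OF assms(2) generator_in_scaled_hull(1)[OF assms(1), of \<alpha> x]] assms(2) by simp

text \<open>
  Absorption makes the infimum defining \<open>rho\<close> range over a nonempty set, and closedness of
  the hull puts \<open>y\<close> in the hull also when the infimum equals \<open>1\<close>.
\<close>
lemma rho_unit_ball:
  fixes x :: "nat \<Rightarrow> 'a::real_normed_vector"
  assumes n: "n \<ge> 1"
    and absorb: "\<exists>r>0. y \<in> (\<lambda>z. r *\<^sub>R z) ` scaled_hull n x \<alpha>"
  shows "rho n x \<alpha> y \<le> 1 \<longleftrightarrow> y \<in> scaled_hull n x \<alpha>"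
proof
  assume "y \<in> scaled_hull n x \<alpha>"
  then show "rho n x \<alpha> y \<le> 1"
    using rho_le[of 1 y] by simp
next
  let ?S = "{r. r > 0 \<and> y \<in> (\<lambda>z. r *\<^sub>R z) ` scaled_hull n x \<alpha>}"
  assume le: "rho n x \<alpha> y \<le> 1"
  (* y = s z with z in the hull and s < 1 / t, so t y = (t s) z is z shrunk towards 0. *)
  have scaled: "t *\<^sub>R y \<in> scaled_hull n x \<alpha>" if t: "0 < t" "t < 1" for t
  proof -
    have "Inf ?S < 1 / t"
      using le t unfolding rho_def by (smt (verit) less_divide_eq_1_pos)
    then obtain s where s: "s \<in> ?S" "s < 1 / t"
      using cInf_lessD[of ?S "1 / t"] absorb by blast
    then obtain z where "s > 0" "z \<in> scaled_hull n x \<alpha>" "y = s *\<^sub>R z"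
      by auto
    with s(2) t scaled_hull_shrink[OF n, of z x \<alpha> "t * s"] show ?thesis
      by (simp add: field_simps)
  qed
  have "(\<lambda>k. (1 - 1 / real (Suc (Suc k))) *\<^sub>R y) \<longlonglongrightarrow> (1 - 0) *\<^sub>R y"
    using LIMSEQ_Suc[OF LIMSEQ_Suc[OF lim_1_over_n]] by (intro tendsto_intros) auto
  then have "(1 - 0) *\<^sub>R y \<in> scaled_hull n x \<alpha>"
  proof (rule closed_sequentially[OF compact_imp_closed[OF compact_scaled_hull], rotated])
    show "(1 - 1 / real (Suc (Suc k))) *\<^sub>R y \<in> scaled_hull n x \<alpha>" for k
      by (rule scaled) (auto simp: field_simps)
  qed
  then show "y \<in> scaled_hull n x \<alpha>" by simp
qed

lemma scaled_hull_absorbs: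
  fixes x :: "nat \<Rightarrow> 'a::real_normed_vector"
  assumes E: "direction_set E" "antipodal_enumeration n x E"
    and n: "n \<ge> 1" and \<alpha>: "\<And>i. i \<in> {1..n} \<Longrightarrow> \<alpha> i > 0"
  shows "\<exists>r>0. y \<in> (\<lambda>z. r *\<^sub>R z) ` scaled_hull n x \<alpha>"
proof -
  define M where "M = (\<Sum>i\<in>{1..n}. \<alpha> i)"
  have M: "0 < M" "\<And>i. i \<in> {1..n} \<Longrightarrow> \<alpha> i \<le> M"
    unfolding M_def using \<alpha> n by (auto intro!: sum_pos member_le_sum simp: less_imp_le)
  have gen: "x i \<in> (\<lambda>z. M *\<^sub>R z) ` scaled_hull n x \<alpha>" "- x i \<in> (\<lambda>z. M *\<^sub>R z) ` scaled_hull n x \<alpha>"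
    if i: "i \<in> {1..n}" for i
  proof -
    have "(\<alpha> i / M) *\<^sub>R (inverse (\<alpha> i) *\<^sub>R x i) \<in> scaled_hull n x \<alpha>"
      "(\<alpha> i / M) *\<^sub>R (- (inverse (\<alpha> i) *\<^sub>R x i)) \<in> scaled_hull n x \<alpha>"
      using M \<alpha> i by (intro scaled_hull_shrink n generator_in_scaled_hull[OF i]; simp add: less_imp_le)+
    then have "inverse M *\<^sub>R x i \<in> scaled_hull n x \<alpha>" "- (inverse M *\<^sub>R x i) \<in> scaled_hull n x \<alpha>"
      using \<alpha>[OF i] by (simp_all add: field_simps)
    moreover have "x i = M *\<^sub>R (inverse M *\<^sub>R x i)" "- x i = M *\<^sub>R (- (inverse M *\<^sub>R x i))"
      using M(1) by auto
    ultimately show "x i \<in> (\<lambda>z. M *\<^sub>R z) ` scaled_hull n x \<alpha>"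
      "- x i \<in> (\<lambda>z. M *\<^sub>R z) ` scaled_hull n x \<alpha>"
      by blast+
  qed
  have "E \<subseteq> (\<lambda>z. M *\<^sub>R z) ` scaled_hull n x \<alpha>"
    using E(2) gen unfolding antipodal_enumeration_def by blast
  then have hull: "convex hull E \<subseteq> (\<lambda>z. M *\<^sub>R z) ` scaled_hull n x \<alpha>"
    by (intro hull_minimal convex_scaling convex_scaled_hull)
  obtain d where d: "d > 0" "cball 0 d \<subseteq> convex hull E"
    using direction_set_hull_absorbs[OF E(1)] by blast
  (* The summand 1 only keeps the factor meaningful at y = 0. *)
  define s where "s = d / (norm y + 1)"
  have s: "s > 0" "s * norm y \<le> d"
    using d(1) by (auto simp: s_def field_simps add_pos_nonneg)
  have "s *\<^sub>R y \<in> (\<lambda>z. M *\<^sub>R z) ` scaled_hull n x \<alpha>"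
    using s d(2) hull by (intro subsetD[OF hull] subsetD[OF d(2)]) auto
  then obtain z where z: "z \<in> scaled_hull n x \<alpha>" "s *\<^sub>R y = M *\<^sub>R z"
    by blast
  have "y = (M / s) *\<^sub>R z"
    using z(2) s(1) by (metis divide_inverse mult.commute scaleR_scaleR scaleR_one
        left_inverse less_irrefl)
  then show ?thesis
    using z(1) M(1) s(1) by (intro exI[of _ "M / s"]) auto
qed

text \<open>Both sides are positively homogeneous, so a norm is determined by its unit ball.\<close>
lemma rho_eq_norm:
  assumes p: "equivalent_norm p" and H: "scaled_hull n x \<alpha> = unit_ball p"
  shows "rho n x \<alpha> y = p y"
proof -
  have hom: "p (c *\<^sub>R z) = \<bar>c\<bar> * p z" for c z
    using p unfolding equivalent_norm_def by blast
  obtain a where a: "a > 0" "\<And>z. a * norm z \<le> p z"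
    using p unfolding equivalent_norm_def by blast
  have nonneg: "p y \<ge> 0"
    using a(1) a(2)[of y] by (smt (verit) mult_nonneg_nonneg norm_ge_zero)
  have "y \<in> (\<lambda>z. r *\<^sub>R z) ` unit_ball p \<longleftrightarrow> p y \<le> r" if r: "r > 0" for r
  proof
    assume "p y \<le> r"
    then have "inverse r *\<^sub>R y \<in> unit_ball p"
      using r by (simp add: unit_ball_def hom field_simps)
    moreover have "y = r *\<^sub>R (inverse r *\<^sub>R y)"
      using r by simp
    ultimately show "y \<in> (\<lambda>z. r *\<^sub>R z) ` unit_ball p"
      by blast
  qed (use r in \<open>auto simp: unit_ball_def hom\<close>)
  then have S: "{r. r > 0 \<and> y \<in> (\<lambda>z. r *\<^sub>R z) ` scaled_hull n x \<alpha>} = {r. r > 0 \<and> p y \<le> r}"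
    unfolding H by blast
  have "Inf {r. r > 0 \<and> p y \<le> r} = p y"
  proof (cases "p y = 0")
    case True
    then have "{r. r > 0 \<and> p y \<le> r} = {0<..}" by auto
    then show ?thesis
      using True by simp
  next
    case False
    then have "{r. r > 0 \<and> p y \<le> r} = {p y..}"
      using nonneg by auto
    then show ?thesis by simp
  qed
  then show ?thesis
    unfolding rho_def S .
qed

section \<open>Norms whose unit ball has extreme points only in the directions of E\<close>

lemma convex_unit_ball:
  assumes "equivalent_norm p"
  shows "convex (unit_ball p)"
proof (rule convexI)
  fix y z :: 'a and u v :: real
  assume yz: "y \<in> unit_ball p" "z \<in> unit_ball p" and uv: "0 \<le> u" "0 \<le> v" "u + v = 1"
  have "p (u *\<^sub>R y + v *\<^sub>R z) \<le> p (u *\<^sub>R y) + p (v *\<^sub>R z)"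
    using assms unfolding equivalent_norm_def by blast
  also have "\<dots> = u * p y + v * p z"
    using assms uv unfolding equivalent_norm_def by auto
  also have "\<dots> \<le> 1"
    using yz uv by (intro convex_bound_le) (auto simp: unit_ball_def)
  finally show "u *\<^sub>R y + v *\<^sub>R z \<in> unit_ball p"
    by (simp add: unit_ball_def)
qed

text \<open>
  The upper estimate by the ambient norm makes \<open>p\<close> Lipschitz and its ball closed; the lower
  one makes the ball bounded.
\<close>
lemma compact_unit_ball:
  fixes p :: "'a::real_normed_vector \<Rightarrow> real" and F :: "'a set"
  assumes p: "equivalent_norm p"
    and F: "finite F" and d: "d > 0" "cball 0 d \<subseteq> convex hull F"
  shows "compact (unit_ball p)"
proof (rule compact_if_bounded_finite_hull_absorbs[OF F d])
  obtain a b where a: "a > 0" "\<And>z. a * norm z \<le> p z" and b: "b > 0" "\<And>z. p z \<le> b * norm z"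
    using p unfolding equivalent_norm_def by blast
  have tri: "p (y + z) \<le> p y + p z" for y z
    using p unfolding equivalent_norm_def by blast
  have "\<bar>p y - p z\<bar> \<le> b * dist y z" for y z
    using tri[of z "y - z"] tri[of y "z - y"] b(2)[of "y - z"] b(2)[of "z - y"]
    by (simp add: dist_norm norm_minus_commute)
  then have "b-lipschitz_on UNIV p"
    using b(1) by (intro lipschitz_onI) (auto simp: dist_real_def)
  then have "continuous_on UNIV p"
    by (rule lipschitz_on_continuous_on)
  then show "closed (unit_ball p)"
    unfolding unit_ball_def by (intro closed_Collect_le) auto
  have "norm z \<le> 1 / a" if "z \<in> unit_ball p" for z
    using that a(1) a(2)[of z] by (simp add: unit_ball_def field_simps)
  then show "bounded (unit_ball p)"
    by (auto simp: bounded_iff)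
qed

theorem theorem3p8:
  fixes E :: "'a::banach set"
    and n :: nat
    and x :: "nat \<Rightarrow> 'a"
    and p :: "'a \<Rightarrow> real"
  assumes "\<exists>B. finite B \<and> span B = (UNIV :: 'a set)"
    and "direction_set E"
    and "antipodal_enumeration n x E"
    and "equivalent_norm p"
  shows "Ext (unit_ball p) \<subseteq> Dir E \<longleftrightarrow>
         (\<exists>\<alpha>. admissible n x \<alpha> \<and> (\<forall>y. p y = rho n x \<alpha> y))"
proof -
  have finE: "finite E" and E1: "\<And>v. v \<in> E \<Longrightarrow> norm v = 1"
    using assms(2) unfolding direction_set_def by auto
  have E_eq: "E = x ` {1..n} \<union> (\<lambda>i. - x i) ` {1..n}"
    using assms(3) unfolding antipodal_enumeration_def by blast
  obtain d where d: "d > 0" "cball 0 d \<subseteq> convex hull E"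
    using direction_set_hull_absorbs[OF assms(2)] by blast
  have n: "n \<ge> 1"
  proof (rule ccontr)
    assume "\<not> n \<ge> 1"
    then have "E = {}" using E_eq by simp
    then show False using d by auto
  qed
  have hom: "p (c *\<^sub>R z) = \<bar>c\<bar> * p z" for c z
    using assms(4) unfolding equivalent_norm_def by blast
  have p_minus: "p (- z) = p z" for z
    using hom[of "-1" z] by simp
  show ?thesis
  proof
    assume ext: "Ext (unit_ball p) \<subseteq> Dir E"
    define \<alpha> where "\<alpha> i = p (x i)" for i
    have pos: "\<alpha> i > 0" if i: "i \<in> {1..n}" for i
    proof -
      obtain a where "a > 0" "a * norm (x i) \<le> p (x i)"
        using assms(4) unfolding equivalent_norm_def by blast
      moreover have "norm (x i) = 1"
        using E1 E_eq i by blast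
      ultimately show ?thesis by (simp add: \<alpha>_def)
    qed
    have "scaled_hull n x \<alpha> \<subseteq> unit_ball p"
      unfolding scaled_hull_def
    proof (intro hull_minimal convex_unit_ball assms(4) Un_least image_subsetI)
      fix i assume "i \<in> {1..n}"
      then have "p (inverse (\<alpha> i) *\<^sub>R x i) = 1"
        using pos[of i] by (simp add: hom \<alpha>_def)
      then show "inverse (\<alpha> i) *\<^sub>R x i \<in> unit_ball p" "- (inverse (\<alpha> i) *\<^sub>R x i) \<in> unit_ball p"
        by (auto simp: unit_ball_def p_minus)
    qed
    moreover have "unit_ball p \<subseteq> scaled_hull n x \<alpha>"
    proof -
      have ext_hull: "Ext (unit_ball p) \<subseteq> scaled_hull n x \<alpha>"
      proof
        fix e assume e: "e \<in> Ext (unit_ball p)"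
        then have "p e \<le> 1"
          by (auto simp: Ext_def extreme_point_of_def unit_ball_def)
        obtain c v where c: "c > 0" and v: "v \<in> E" and ev: "e = c *\<^sub>R v"
          using e ext unfolding Dir_def by blast
        obtain i where i: "i \<in> {1..n}" and vi: "v = x i \<or> v = - x i"
          using v E_eq by blast
        have "p v = \<alpha> i"
          using vi by (auto simp: \<alpha>_def p_minus)
        then have "c * \<alpha> i \<le> 1"
          using \<open>p e \<le> 1\<close> c by (simp add: ev hom)
        moreover have "inverse (\<alpha> i) *\<^sub>R v \<in> scaled_hull n x \<alpha>"
          using vi generator_in_scaled_hull[OF i, of \<alpha> x] by auto
        ultimately have "(c * \<alpha> i) *\<^sub>R (inverse (\<alpha> i) *\<^sub>R v) \<in> scaled_hull n x \<alpha>"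
          using c pos[OF i] by (intro scaled_hull_shrink[OF n, of "inverse (\<alpha> i) *\<^sub>R v"]) simp_all
        moreover have "\<alpha> i \<noteq> 0"
          using pos[OF i] by simp
        ultimately show "e \<in> scaled_hull n x \<alpha>"
          by (simp add: ev mult.assoc)
      qed
      obtain q :: "'a \<Rightarrow> real" where q: "continuous_on UNIV q"
        and strict: "\<And>a b z. z \<in> open_segment a b \<Longrightarrow> q z < max (q a) (q b)"
        using strictly_quasiconvex_function_exists[OF assms(1) finE d] by metis
      show ?thesis
        using compact_subset_if_extreme_points_subset[OF compact_unit_ball[OF assms(4) finE d]
            compact_scaled_hull convex_scaled_hull ext_hull
            continuous_on_subset[OF q subset_UNIV] strict] .
    qed
    ultimately have rho_p: "rho n x \<alpha> y = p y" for y
      using rho_eq_norm[OF assms(4)] by (metis subset_antisym)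
    have "rho n x (\<alpha>(i := \<alpha> i - \<epsilon>)) \<noteq> rho n x \<alpha>"
      if i: "i \<in> {1..n}" and \<epsilon>: "0 < \<epsilon>" "\<epsilon> < \<alpha> i" for i \<epsilon>
    proof -
      have "rho n x (\<alpha>(i := \<alpha> i - \<epsilon>)) (x i) \<le> \<alpha> i - \<epsilon>"
        using rho_generator_le[OF i, of "\<alpha>(i := \<alpha> i - \<epsilon>)" x] \<epsilon> by simp
      also have "\<dots> < rho n x \<alpha> (x i)"
        using \<epsilon> by (simp add: rho_p \<alpha>_def)
      finally show ?thesis by auto
    qed
    then have "admissible n x \<alpha>"
      using pos unfolding admissible_def by blast
    then show "\<exists>\<alpha>. admissible n x \<alpha> \<and> (\<forall>y. p y = rho n x \<alpha> y)"
      using rho_p by auto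
  next
    assume "\<exists>\<alpha>. admissible n x \<alpha> \<and> (\<forall>y. p y = rho n x \<alpha> y)"
    then obtain \<alpha> where adm: "admissible n x \<alpha>" and p_rho: "\<And>y. p y = rho n x \<alpha> y"
      by blast
    have pos: "\<alpha> i > 0" if "i \<in> {1..n}" for i
      using adm that unfolding admissible_def by blast
    have ball: "unit_ball p = scaled_hull n x \<alpha>"
      unfolding unit_ball_def p_rho
      using rho_unit_ball[OF n scaled_hull_absorbs[OF assms(2,3) n, of \<alpha>]] pos by auto
    show "Ext (unit_ball p) \<subseteq> Dir E"
    proof
      fix e assume "e \<in> Ext (unit_ball p)"
      then have "e \<in> (\<lambda>i. inverse (\<alpha> i) *\<^sub>R x i) ` {1..n}
          \<union> (\<lambda>i. - (inverse (\<alpha> i) *\<^sub>R x i)) ` {1..n}"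
        unfolding ball Ext_def scaled_hull_def by (metis extreme_point_of_convex_hull mem_Collect_eq)
      then obtain i where i: "i \<in> {1..n}"
        and e: "e = inverse (\<alpha> i) *\<^sub>R x i \<or> e = inverse (\<alpha> i) *\<^sub>R (- x i)"
        by auto
      have "x i \<in> E" "- x i \<in> E"
        using i E_eq by auto
      moreover have "inverse (\<alpha> i) > 0"
        using pos[OF i] by simp
      ultimately show "e \<in> Dir E"
        unfolding Dir_def using e by blast
    qed
  qed
qed

end
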